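(* Let $A\in\mathbb{C}^{n\times n}_r$ be represented by its Hartwig-Spindelb\"{o}ck decomposition $A=U\left(\begin{array}{cc}\Sigma K & \Sigma L\\ 0 & 0\end{array}\right)U^*$ (with $U$ unitary, $\Sigma={\rm diag}(\sigma_1,\dots,\sigma_r)$ the positive singular values, $KK^*+LL^*=I_r$), and assume ${\rm rank}(A^{\sim}AA^{\sim})={\rm rank}(A)$. Write $\left(\begin{array}{cc}G_1 & G_2\\ G_3 & G_4\end{array}\right)=U^*GU$ with $G_1\in\mathbb{C}^{r\times r}$, and $\Delta=\left(\begin{array}{cc}K & L\end{array}\right)U^*GU\left(\begin{array}{c}K^*\\ L^*\end{array}\right)$. Let $B,C,X\in\mathbb{C}^{n\times n}$. Then $X=A^{\mathfrak{m}}$ is the unique solution of the rank equation ${\rm rank}\left(\begin{array}{cc}A & B\\ C & X\end{array}\right)={\rm rank}(A)$ if and only if \[ B=U\left(\begin{array}{cc}B_1 & B_2\\ 0 & 0\end{array}\right)U^*G \quad\text{and}\quad C=GUTU^*, \] where \begin{align*} T&=\left(\begin{array}{cc}J_1\Sigma K & J_1\Sigma L\\ J_3\Sigma K & J_3\Sigma L\end{array}\right),\\ B_1&=\left(\begin{array}{cc}\Sigma K & \Sigma L\end{array}\right)\left[T^{(1)}\left(\begin{array}{c}K^*(G_1\Sigma\Delta)^{-1}\\ L^*(G_1\Sigma\Delta)^{-1}\end{array}\right)+(I_n-T^{(1)}T)Y_1\right],\\ B_2&=\left(\begin{array}{cc}\Sigma K & \Sigma L\end{array}\right)(I_n-T^{(1)}T)Y_2,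 \end{align*} with $J_1\in\mathbb{C}^{r\times r}$ and $J_3\in\mathbb{C}^{(n-r)\times r}$ satisfying $\mathcal{N}(T^* )\subseteq\mathcal{N}\left(\left(\begin{array}{cc}K & L\end{array}\right)\right)$, $Y_1\in\mathbb{C}^{n\times r}$ and $Y_2\in\mathbb{C}^{n\times(n-r)}$ arbitrary, and $T^{(1)}$ any matrix with $TT^{(1)}T=T$.
   Context: $G=\left(\begin{array}{cc}1&0\\0&-I_{n-1}\end{array}\right)$ is the Minkowski metric matrix; the Minkowski adjoint is $A^{\sim}=GA^*G$ for square $A$ (in general $A^{\sim}=GA^*F$). The Minkowski inverse $A^{\mathfrak{m}}$ is the unique $X$ with $AXA=A$, $XAX=X$, $(AX)^{\sim}=AX$, $(XA)^{\sim}=XA$; under the rank hypothesis it exists, and $G_1$ and $\Delta$ are nonsingular. *)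

theory Defs
  imports "Jordan_Normal_Form.DL_Rank" "Jordan_Normal_Form.Schur_Decomposition"
          "Jordan_Normal_Form.Matrix_Kernel"
begin

abbreviation crank :: "complex mat \<Rightarrow> nat" where
  "crank M \<equiv> vec_space.rank (dim_row M) M"

definition unitary_mat :: "complex mat \<Rightarrow> bool" where
  "unitary_mat U \<longleftrightarrow> U \<in> carrier_mat (dim_row U) (dim_row U) \<and>
     U * mat_adjoint U = 1\<^sub>m (dim_row U) \<and> mat_adjoint U * U = 1\<^sub>m (dim_row U)"

definition mink_G :: "nat \<Rightarrow> complex mat" where
  "mink_G n = mat n n (\<lambda>(i,j). if i = j then (if i = 0 then 1 else -1) else 0)"

definition mink_adj :: "complex mat \<Rightarrow> complex mat" where
  "mink_adj M = mink_G (dim_row M) * mat_adjoint M * mink_G (dim_row M)"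

definition mink_inv :: "complex mat \<Rightarrow> complex mat" where
  "mink_inv A = (THE X. X \<in> carrier_mat (dim_col A) (dim_row A) \<and>
      A * X * A = A \<and> X * A * X = X \<and>
      mink_adj (A * X) = A * X \<and> mink_adj (X * A) = X * A)"

definition inv_mat :: "complex mat \<Rightarrow> complex mat" where
  "inv_mat M = (THE N. N \<in> carrier_mat (dim_row M) (dim_row M) \<and>
      M * N = 1\<^sub>m (dim_row M) \<and> N * M = 1\<^sub>m (dim_row M))"

definition hcat :: "complex mat \<Rightarrow> complex mat \<Rightarrow> complex mat" where
  "hcat P Q = four_block_mat P Q (0\<^sub>m 0 (dim_col P)) (0\<^sub>m 0 (dim_col Q))"

definition vcat :: "complex mat \<Rightarrow> complex mat \<Rightarrow> complex mat" where
  "vcat P Q = four_block_mat P (0\<^sub>m (dim_row P) 0) Q (0\<^sub>m (dim_row Q) 0)"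

end

theory Submission
  imports Defs
begin

text \<open>
  The decomposition gives a full-rank factorization $A = PQ$ with $P = U (I\ 0)^T$ and
  $Q = \Sigma (K\ L) U^*$. Comparing rank factorizations, the block matrix has rank $r$ iff
  $B = Pb$, $C = cQ$ and $X = cb$ for some $b$, $c$, which are then unique. The rank hypothesis makes
  $P^*GP = G_1$ and $QGQ^* = \Sigma\Delta\Sigma$ invertible, so that
  $A^{\mathfrak{m}} = GQ^*(QGQ^*)^{-1}(P^*GP)^{-1}P^*G$, and the rank equation characterizes
  $A^{\mathfrak{m}}$ iff $cb = A^{\mathfrak{m}}$. Writing $c = GUJ$ and $b = (B_1\ B_2)U^*G$, this becomes
  $JB_1 = (K\ L)^*M$ and $JB_2 = 0$ with $M = (G_1\Sigma\Delta)^{-1}$. The first equation forces $J$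
  to be left invertible, so $(\Sigma K\ \Sigma L)(I - T^{(1)}T) = 0$: the free parameters
  $Y_1$, $Y_2$ do not contribute and $B_2 = 0$.
\<close>

subsection \<open>Rank factorizations\<close>

text \<open>Padding \<open>H\<close> with zero rows gives a square matrix of determinant zero, and a
  kernel vector of the padded matrix is also a kernel vector of \<open>H\<close>.\<close>

lemma wide_mat_kernel_nontrivial:
  fixes H :: "'a :: field mat"
  assumes H: "H \<in> carrier_mat k s" and ks: "k < s"
  shows "\<exists>v \<in> carrier_vec s. v \<noteq> 0\<^sub>v s \<and> H *\<^sub>v v = 0\<^sub>v k"
proof -
  define M where "M = mat s s (\<lambda>(i,j). if i < k then H $$ (i,j) else 0)"
  have M: "M \<in> carrier_mat s s" by (simp add: M_def)
  \<comment> \<open>Row \<open>k\<close> is the first padding row; it exists because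
    \<open>k < s\<close>. Being zero, it puts the unit vector with index \<open>k\<close> into the
    kernel of the transpose.\<close>
  have "transpose_mat M *\<^sub>v unit_vec s k = 0\<^sub>v s"
  proof (rule eq_vecI)
    fix i assume "i < dim_vec (0\<^sub>v s :: 'a vec)"
    hence i: "i < s" by simp
    have "(transpose_mat M *\<^sub>v unit_vec s k) $ i = col M i \<bullet> unit_vec s k" using i M by simp
    also have "\<dots> = col M i $ k" using i M ks by (intro scalar_prod_right_unit) auto
    also have "\<dots> = 0" using i ks by (simp add: M_def)
    finally show "(transpose_mat M *\<^sub>v unit_vec s k) $ i = 0\<^sub>v s $ i" using i by simp
  qed (use M in simp)
  hence "\<exists>v. v \<in> carrier_vec s \<and> v \<noteq> 0\<^sub>v s \<and> transpose_mat M *\<^sub>v v = 0\<^sub>v s"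
    using ks M by (intro exI[of _ "unit_vec s k"]) auto
  hence "det (transpose_mat M) = 0"
    using det_0_iff_vec_prod_zero_field[of "transpose_mat M" s] M by auto
  hence "det M = 0" using det_transpose[OF M] by simp
  then obtain v where v: "v \<in> carrier_vec s" "v \<noteq> 0\<^sub>v s" "M *\<^sub>v v = 0\<^sub>v s"
    using det_0_iff_vec_prod_zero_field[OF M] by auto
  have "H *\<^sub>v v = 0\<^sub>v k"
  proof (rule eq_vecI)
    fix i assume "i < dim_vec (0\<^sub>v k :: 'a vec)"
    hence i: "i < k" by simp
    have "row H i = row M i" using i ks H by (auto simp: M_def)
    moreover have "(M *\<^sub>v v) $ i = 0" using v i ks by simp
    ultimately show "(H *\<^sub>v v) $ i = 0\<^sub>v k $ i" using i ks H M by simp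
  qed (use H in simp)
  thus ?thesis using v by blast
qed

context vec_space
begin

text \<open>A column outside the span of a maximal independent set of columns could be adjoined to
  it, against maximality. The set is delivered as a distinct list so that it can serve as the
  columns of a matrix.\<close>

lemma maximal_indpt_cols:
  assumes A: "A \<in> carrier_mat n nc"
  obtains xs where "distinct xs" "set xs \<subseteq> set (cols A)" "lin_indpt (set xs)"
    "length xs = rank A" "set (cols A) \<subseteq> span (set xs)"
proof -
  obtain S where S: "maximal S (\<lambda>T. T \<subseteq> set (cols A) \<and> lin_indpt T)"
    using maximal_exists[of "(\<lambda>T. T \<subseteq> set (cols A) \<and> lin_indpt T)" "card (set (cols A))" "{}"]
    by (meson List.finite_set card_mono empty_iff empty_subsetI finite_lin_indpt2 rev_finite_subset)
  have sub: "S \<subseteq> set (cols A)" and li: "lin_indpt S" using S by (auto simp: maximal_def)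
  have colsA: "set (cols A) \<subseteq> carrier_vec n" using cols_dim A by blast
  have SV: "S \<subseteq> carrier_vec n" using sub colsA by blast
  have fin: "finite S" using sub finite_subset by blast
  have "v \<in> span S" if v: "v \<in> set (cols A)" for v
  proof (rule ccontr)
    assume ns: "v \<notin> span S"
    have "v \<notin> S" using ns span_mem[of S v] SV by argo
    have indpt: "lin_indpt (S \<union> {v})"
      using lin_dep_iff_in_span[OF SV li subsetD[OF colsA v] \<open>v \<notin> S\<close>] ns by argo
    have "S \<union> {v} \<subseteq> set (cols A)" using sub v by simp
    hence "S \<union> {v} = S" using S indpt unfolding maximal_def
      by (metis (no_types, lifting) sup_ge1)
    thus False using \<open>v \<notin> S\<close> by blast
  qed
  hence sp: "set (cols A) \<subseteq> span S" by blast
  obtain xs where xs: "set xs = S" "distinct xs" using finite_distinct_list[OF fin] by blast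
  have "length xs = rank A" using rank_card_indpt[OF A S] distinct_card[OF xs(2)] xs(1) by simp
  thus ?thesis using that[of xs] sub li xs sp by blast
qed

text \<open>The selected independent columns form \<open>F\<close>, and the coordinates of each
  column of \<open>A\<close> with respect to them form the columns of \<open>H\<close>.\<close>

lemma rank_factorization:
  assumes A: "A \<in> carrier_mat n nc"
  obtains F H where "F \<in> carrier_mat n (rank A)" "H \<in> carrier_mat (rank A) nc" "A = F * H"
proof -
  obtain xs where xs: "distinct xs" "set xs \<subseteq> set (cols A)" "length xs = rank A"
    "set (cols A) \<subseteq> span (set xs)"
    using maximal_indpt_cols[OF A] by metis
  have xsc: "set xs \<subseteq> carrier_vec n" using xs cols_dim A by blast
  define F where "F = mat_of_cols n xs"
  have F: "F \<in> carrier_mat n (rank A)" using xs by (simp add: F_def carrier_matI)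
  have colsF: "cols F = xs" using xsc by (simp add: F_def)
  have "\<exists>h \<in> carrier_vec (rank A). col A j = F *\<^sub>v h" if "j < nc" for j
  proof -
    have "col A j \<in> span (set xs)" using that A xs cols_length[of A] cols_nth[of j A]
      by (metis carrier_matD(2) nth_mem subsetD)
    then obtain a where "lincomb a (set xs) = col A j"
      using finite_in_span[of "set xs"] xsc by auto
    thus ?thesis using mat_mult_eq_lincomb[OF F, of a] colsF xs
      by (metis vec_carrier)
  qed
  then obtain h where h: "\<And>j. j < nc \<Longrightarrow> h j \<in> carrier_vec (rank A) \<and> col A j = F *\<^sub>v h j" by metis
  define H where "H = mat_of_cols (rank A) (map h [0..<nc])"
  have H: "H \<in> carrier_mat (rank A) nc" by (simp add: H_def carrier_matI)
  have "A = F * H"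
  proof (rule mat_col_eqI)
    fix j assume "j < dim_col (F * H)"
    hence j: "j < nc" using H by simp
    have "col H j = h j" using j h by (simp add: H_def)
    thus "col A j = col (F * H) j" using col_mult2[OF F H j] h[OF j] by simp
  qed (use A F H in auto)
  thus ?thesis using that F H by blast
qed

text \<open>More than \<open>k\<close> independent columns of \<open>F * H\<close> would form a
  matrix \<open>F * H'\<close> with \<open>H'\<close> wider than high. A nonzero kernel vector of
  \<open>H'\<close> is then a linear relation between these columns.\<close>

lemma rank_mult_le_inner:
  assumes F: "F \<in> carrier_mat n k" and H: "H \<in> carrier_mat k nc"
  shows "rank (F * H) \<le> k"
proof (rule ccontr)
  assume gt: "\<not> rank (F * H) \<le> k"
  have FH: "F * H \<in> carrier_mat n nc" using F H by simp
  obtain xs where xs: "distinct xs" "set xs \<subseteq> set (cols (F * H))" "lin_indpt (set xs)"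
    "length xs = rank (F * H)"
    using maximal_indpt_cols[OF FH] by metis
  have xsc: "set xs \<subseteq> carrier_vec n" using xs cols_dim FH by blast
  define s where "s = length xs"
  define B where "B = mat_of_cols n xs"
  have B: "B \<in> carrier_mat n s" by (simp add: B_def s_def)
  have colsB: "cols B = xs" using xsc by (simp add: B_def)
  have "\<exists>h \<in> carrier_vec k. xs ! j = F *\<^sub>v h" if "j < s" for j
  proof -
    have "xs ! j \<in> set (cols (F * H))" using that xs by (auto simp: s_def)
    then obtain i where "i < nc" "xs ! j = col (F * H) i"
      using FH by (metis carrier_matD(2) cols_length cols_nth in_set_conv_nth)
    thus ?thesis using col_mult2[OF F H] H by auto
  qed
  then obtain h where h: "\<And>j. j < s \<Longrightarrow> h j \<in> carrier_vec k \<and> xs ! j = F *\<^sub>v h j" by metis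
  define H' where "H' = mat_of_cols k (map h [0..<s])"
  have H': "H' \<in> carrier_mat k s" by (simp add: H'_def carrier_matI)
  have BF: "B = F * H'"
  proof (rule mat_col_eqI)
    fix j assume "j < dim_col (F * H')"
    hence j: "j < s" using H' by simp
    have "col H' j = h j" using j h by (simp add: H'_def)
    moreover have "xs ! j \<in> carrier_vec n" using j xsc by (auto simp: s_def)
    hence "col B j = xs ! j" using j by (simp add: B_def s_def)
    ultimately show "col B j = col (F * H') j" using col_mult2[OF F H' j] h[OF j] by simp
  qed (use B F H' in auto)
  have "k < s" using gt xs by (simp add: s_def)
  then obtain v where v: "v \<in> carrier_vec s" "v \<noteq> 0\<^sub>v s" "H' *\<^sub>v v = 0\<^sub>v k"
    using wide_mat_kernel_nontrivial[OF H'] by blast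
  have "B *\<^sub>v v = F *\<^sub>v 0\<^sub>v k" using F H' v by (simp add: BF)
  also have "\<dots> = 0\<^sub>v n" using F by (intro eq_vecI) auto
  finally have "B *\<^sub>v v = 0\<^sub>v n" .
  thus False using lin_depI[OF B v(1,2)] colsB xs by simp
qed

end

lemma crank_factorization:
  assumes A: "A \<in> carrier_mat m nc"
  obtains F H where "F \<in> carrier_mat m (crank A)" "H \<in> carrier_mat (crank A) nc" "A = F * H"
  using that unfolding carrier_matD(1)[OF A] by (rule vec_space.rank_factorization[OF A])

lemma crank_mult_le:
  assumes "F \<in> carrier_mat m k" "H \<in> carrier_mat k nc"
  shows "crank (F * H) \<le> k"
  using vec_space.rank_mult_le_inner[OF assms] assms by simp

text \<open>Replaces rank by the existence of factorizations, the only form in which rank enters the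
  block argument below.\<close>

lemma crank_le_iff:
  assumes A: "A \<in> carrier_mat m nc"
  shows "crank A \<le> k \<longleftrightarrow> (\<exists>F H. F \<in> carrier_mat m k \<and> H \<in> carrier_mat k nc \<and> A = F * H)"
proof
  assume le: "crank A \<le> k"
  define l where "l = crank A"
  have l: "l \<le> k" using le l_def by simp
  obtain F H where F: "F \<in> carrier_mat m l" and H: "H \<in> carrier_mat l nc" and AF: "A = F * H"
    unfolding l_def by (rule crank_factorization[OF A])
  \<comment> \<open>Raises the inner dimension from \<open>l\<close> to \<open>k\<close>: zero
    columns are appended to \<open>F\<close> and zero rows to \<open>H\<close>, while the empty
    blocks only complete the four-block format.\<close>
  let ?F = "four_block_mat F (0\<^sub>m m (k - l)) (0\<^sub>m 0 l) (0\<^sub>m 0 (k - l))"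
  let ?H = "four_block_mat H (0\<^sub>m l 0) (0\<^sub>m (k - l) nc) (0\<^sub>m (k - l) 0)"
  have "?F * ?H = four_block_mat A (0\<^sub>m m 0) (0\<^sub>m 0 nc) (0\<^sub>m 0 0)"
    using F H AF by (subst mult_four_block_mat) auto
  also have "\<dots> = A" using A by (intro eq_matI) auto
  finally show "\<exists>F H. F \<in> carrier_mat m k \<and> H \<in> carrier_mat k nc \<and> A = F * H"
    using F H l by (intro exI[of _ ?F] exI[of _ ?H]) auto
next
  assume "\<exists>F H. F \<in> carrier_mat m k \<and> H \<in> carrier_mat k nc \<and> A = F * H"
  thus "crank A \<le> k" using crank_mult_le by blast
qed

subsection \<open>Adjoints and the Minkowski inverse\<close>

lemma mat_mult_assoc: "dim_col A = dim_row B \<Longrightarrow> dim_col B = dim_row C \<Longrightarrow> A * B * C = A * (B * C)"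
  for A B C :: "'a :: semiring_0 mat"
  by (rule assoc_mult_mat[of _ "dim_row A" "dim_row B" _ "dim_row C" _ "dim_col C"]) auto

lemma mat_mult_one_left: "dim_row A = k \<Longrightarrow> 1\<^sub>m k * A = A"
  and mat_mult_one_right: "dim_col A = k \<Longrightarrow> A * 1\<^sub>m k = A"
  for A :: "'a :: semiring_1 mat"
  using left_mult_one_mat[of A k "dim_col A"] right_mult_one_mat[of A "dim_row A" k] by auto

text \<open>Associativity and unit laws keyed on dimensions rather than carriers, so that the simplifier
  needs no instantiation of the intermediate dimensions.\<close>
lemmas mat_assoc = mat_mult_assoc mat_mult_one_left mat_mult_one_right

text \<open>Right-nested products hide \<open>A * B\<close> as a subterm; in this form a known
  product can still be rewritten there. Most cancellations below are instances.\<close>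

lemma mat_mult_cancel: "A * B = C \<Longrightarrow> dim_col A = dim_row B \<Longrightarrow> dim_col B = dim_row X \<Longrightarrow> A * (B * X) = C * X"
  for A B C X :: "'a :: semiring_0 mat"
  by (metis mat_mult_assoc)

lemma mat_adjoint_eq: "mat_adjoint A = mat (dim_col A) (dim_row A) (\<lambda>(i,j). conjugate (A $$ (j,i)))"
  by (rule eq_matI) (auto simp: mat_adjoint_def mat_of_rows_def)

lemma dim_mat_adjoint [simp]: "dim_row (mat_adjoint A) = dim_col A" "dim_col (mat_adjoint A) = dim_row A"
  by (simp_all add: mat_adjoint_eq)

lemma mat_adjoint_adjoint [simp]: "mat_adjoint (mat_adjoint A) = A"
  by (rule eq_matI) (auto simp: mat_adjoint_eq)

lemma mat_adjoint_one [simp]: "mat_adjoint (1\<^sub>m k :: complex mat) = 1\<^sub>m k"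
  by (rule eq_matI) (auto simp: mat_adjoint_eq)

lemma mat_adjoint_mult:
  fixes A B :: "complex mat"
  assumes "dim_col A = dim_row B"
  shows "mat_adjoint (A * B) = mat_adjoint B * mat_adjoint A"
  by (rule eq_matI)
    (use assms in \<open>auto simp: mat_adjoint_eq scalar_prod_def sum_conjugate conjugate_dist_mul mult.commute
      intro!: sum.cong\<close>)

lemma mink_G_dim [simp]: "dim_row (mink_G n) = n" "dim_col (mink_G n) = n"
  by (simp_all add: mink_G_def)

lemma mink_G_adjoint [simp]: "mat_adjoint (mink_G n) = mink_G n"
  by (rule eq_matI) (auto simp: mat_adjoint_eq mink_G_def)

lemma mink_G_square [simp]: "mink_G n * mink_G n = 1\<^sub>m n"
proof (rule eq_matI)
  fix i j assume ij: "i < dim_row (1\<^sub>m n :: complex mat)" "j < dim_col (1\<^sub>m n :: complex mat)"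
  have "(mink_G n * mink_G n) $$ (i, j) = (\<Sum>k<n. mink_G n $$ (i, k) * mink_G n $$ (k, j))"
    using ij by (simp add: scalar_prod_def atLeast0LessThan)
  also have "\<dots> = (\<Sum>k<n. if k = i then (if i = j then 1 else 0) else 0)"
    using ij by (intro sum.cong) (auto simp: mink_G_def)
  also have "\<dots> = 1\<^sub>m n $$ (i, j)" using ij by auto
  finally show "(mink_G n * mink_G n) $$ (i, j) = 1\<^sub>m n $$ (i, j)" .
qed auto

lemma mink_G_cancel [simp]: "dim_row X = n \<Longrightarrow> mink_G n * (mink_G n * X) = X"
  using mat_mult_cancel[OF mink_G_square, of n X] by (simp add: mat_assoc)

lemma dim_mink_adj [simp]:
  "dim_row (mink_adj A) = dim_row A" "dim_col (mink_adj A) = dim_row A"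
  by (simp_all add: mink_adj_def)

text \<open>The two copies of the metric that meet in the middle cancel, because its square is the
  identity.\<close>

lemma mink_adj_mult:
  assumes "A \<in> carrier_mat n n" "B \<in> carrier_mat n n"
  shows "mink_adj (A * B) = mink_adj B * mink_adj A"
proof -
  have "dim_row A = n" "dim_col A = n" "dim_row B = n" "dim_col B = n" using assms by auto
  thus ?thesis by (simp add: mink_adj_def mat_adjoint_mult mat_assoc)
qed

text \<open>Penrose's uniqueness argument works for the Minkowski adjoint, since it uses only that
  the adjoint reverses products: self-adjointness swaps the factors of \<open>A * X * A * Y\<close>,
  so \<open>A * X = A * Y\<close>, and likewise \<open>X * A = Y * A\<close>.\<close>

lemma mink_inv_eqI:
  assumes A: "A \<in> carrier_mat n n" and X: "X \<in> carrier_mat n n"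
    and X1: "A * X * A = A" and X2: "X * A * X = X"
    and X3: "mink_adj (A * X) = A * X" and X4: "mink_adj (X * A) = X * A"
  shows "mink_inv A = X"
  unfolding mink_inv_def
proof (rule the_equality)
  show "X \<in> carrier_mat (dim_col A) (dim_row A) \<and> A * X * A = A \<and> X * A * X = X \<and>
    mink_adj (A * X) = A * X \<and> mink_adj (X * A) = X * A"
    using assms by auto
next
  fix Y
  assume "Y \<in> carrier_mat (dim_col A) (dim_row A) \<and> A * Y * A = A \<and> Y * A * Y = Y \<and>
    mink_adj (A * Y) = A * Y \<and> mink_adj (Y * A) = Y * A"
  hence Y: "Y \<in> carrier_mat n n" and Y1: "A * Y * A = A" and Y2: "Y * A * Y = Y"
    and Y3: "mink_adj (A * Y) = A * Y" and Y4: "mink_adj (Y * A) = Y * A"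
    using A by auto
  have d: "dim_row A = n" "dim_col A = n" "dim_row X = n" "dim_col X = n" "dim_row Y = n" "dim_col Y = n"
    using A X Y by auto
  have "A * X = (A * Y) * (A * X)"
    using arg_cong[OF Y1, of "\<lambda>M. M * X"] by (simp add: mat_assoc d)
  also have "\<dots> = mink_adj ((A * X) * (A * Y))"
    by (subst mink_adj_mult[of _ n]) (use A X Y X3 Y3 in auto)
  also have "(A * X) * (A * Y) = A * Y"
    using arg_cong[OF X1, of "\<lambda>M. M * Y"] by (simp add: mat_assoc d)
  finally have AX: "A * X = A * Y" using Y3 by simp
  have "X * A = (X * A) * (Y * A)"
    using arg_cong[OF Y1, of "\<lambda>M. X * M"] by (simp add: mat_assoc d)
  also have "\<dots> = mink_adj ((Y * A) * (X * A))"
    by (subst mink_adj_mult[of _ n]) (use A X Y X4 Y4 in auto)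
  also have "(Y * A) * (X * A) = Y * A"
    using arg_cong[OF X1, of "\<lambda>M. Y * M"] by (simp add: mat_assoc d)
  finally have XA: "X * A = Y * A" using Y4 by simp
  have "Y = Y * (A * Y)" using Y2 by (simp add: mat_assoc d)
  also have "\<dots> = (Y * A) * X" by (simp add: AX[symmetric] mat_assoc d)
  also have "\<dots> = X" by (simp add: XA[symmetric] X2)
  finally show "Y = X" .
qed

text \<open>For square matrices a right inverse is also a left inverse, so one product identifies
  the inverse.\<close>

lemma inv_mat_eqI:
  assumes M: "M \<in> carrier_mat k k" and N: "N \<in> carrier_mat k k" and MN: "M * N = 1\<^sub>m k"
  shows "inv_mat M = N"
  unfolding inv_mat_def
proof (rule the_equality)
  have NM: "N * M = 1\<^sub>m k" by (rule mat_mult_left_right_inverse[OF M N MN])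
  have d: "dim_row M = k" "dim_col M = k" "dim_row N = k" "dim_col N = k" using M N by auto
  show "N \<in> carrier_mat (dim_row M) (dim_row M) \<and> M * N = 1\<^sub>m (dim_row M) \<and> N * M = 1\<^sub>m (dim_row M)"
    using N MN NM d by simp
  fix N' assume "N' \<in> carrier_mat (dim_row M) (dim_row M) \<and> M * N' = 1\<^sub>m (dim_row M) \<and> N' * M = 1\<^sub>m (dim_row M)"
  hence N': "dim_row N' = k" "dim_col N' = k" "N' * M = 1\<^sub>m k" using d by auto
  have "N' = N' * (M * N)" using MN N' by (simp add: mat_assoc)
  also have "\<dots> = N" using mat_mult_cancel[OF N'(3), of N] d N' by (simp add: mat_assoc)
  finally show "N' = N" .
qed

text \<open>The Minkowski analogue of the full-rank formula for the Moore-Penrose inverse. Here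
  \<open>N\<close> and \<open>R\<close> invert the Gram matrices of \<open>P\<close> and of the
  adjoint of \<open>Q\<close> for the indefinite form; these are Hermitian, which yields both
  symmetry conditions.\<close>

lemma mink_inv_full_rank_factorization:
  assumes P: "P \<in> carrier_mat n r" and Q: "Q \<in> carrier_mat r n"
    and N: "N \<in> carrier_mat r r" and R: "R \<in> carrier_mat r r"
    and PN: "(mat_adjoint P * (mink_G n * P)) * N = 1\<^sub>m r"
    and QR: "(Q * (mink_G n * mat_adjoint Q)) * R = 1\<^sub>m r"
  shows "mink_inv (P * Q) = mink_G n * (mat_adjoint Q * (R * (N * (mat_adjoint P * mink_G n))))"
proof -
  define N1 where "N1 = mat_adjoint P * (mink_G n * P)"
  define R1 where "R1 = Q * (mink_G n * mat_adjoint Q)"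
  have d: "dim_row P = n" "dim_col P = r" "dim_row Q = r" "dim_col Q = n"
    "dim_row N = r" "dim_col N = r" "dim_row R = r" "dim_col R = r"
    "dim_row N1 = r" "dim_col N1 = r" "dim_row R1 = r" "dim_col R1 = r"
    using P Q N R by (auto simp: N1_def R1_def)
  have carr: "N1 \<in> carrier_mat r r" "R1 \<in> carrier_mat r r" using d by auto
  have NN: "N1 * N = 1\<^sub>m r" "N * N1 = 1\<^sub>m r" and RR: "R1 * R = 1\<^sub>m r" "R * R1 = 1\<^sub>m r"
    using PN QR mat_mult_left_right_inverse[of N1 r N] mat_mult_left_right_inverse[of R1 r R] N R carr
    by (auto simp: N1_def R1_def)
  have herm: "mat_adjoint N1 = N1" "mat_adjoint R1 = R1"
    by (simp_all add: N1_def R1_def mat_adjoint_mult mat_assoc d)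
  \<comment> \<open>The inverse of a Hermitian matrix is Hermitian: the adjoint of \<open>Y\<close>
    is again a left inverse of \<open>X\<close>.\<close>
  have self_adj: "mat_adjoint Y = Y" if "Y \<in> carrier_mat r r" "X \<in> carrier_mat r r" "mat_adjoint X = X" "X * Y = 1\<^sub>m r" "Y * X = 1\<^sub>m r" for X Y :: "complex mat"
  proof -
    have dd: "dim_row X = r" "dim_col X = r" "dim_row Y = r" "dim_col Y = r" using that by auto
    have "mat_adjoint Y * X = 1\<^sub>m r"
      using arg_cong[OF that(4), of mat_adjoint] that(3) by (simp add: mat_adjoint_mult dd)
    hence "mat_adjoint Y * (X * Y) = 1\<^sub>m r * Y"
      using mat_mult_cancel[of "mat_adjoint Y" X "1\<^sub>m r" Y] dd by simp
    thus ?thesis using that(4) by (simp add: mat_assoc dd)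
  qed
  have hN: "mat_adjoint N = N" "mat_adjoint R = R"
    using self_adj[of N N1] self_adj[of R R1] N R carr herm NN RR by auto
  note c = mat_mult_cancel[OF NN(1)] mat_mult_cancel[OF NN(2)] mat_mult_cancel[OF RR(1)]
    mat_mult_cancel[OF RR(2)]
  have fold1: "mat_adjoint P * (mink_G n * (P * Z)) = N1 * Z" if "dim_row Z = r" for Z
    using that by (simp add: N1_def mat_assoc d)
  have fold2: "Q * (mink_G n * (mat_adjoint Q * Z)) = R1 * Z" if "dim_row Z = r" for Z
    using that by (simp add: R1_def mat_assoc d)
  let ?X = "mink_G n * (mat_adjoint Q * (R * (N * (mat_adjoint P * mink_G n))))"
  \<comment> \<open>In each of the two products one Gram matrix meets its inverse, leaving a visibly
    Minkowski self-adjoint expression.\<close>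
  have AX: "P * Q * ?X = P * (N * (mat_adjoint P * mink_G n))"
    by (simp add: mat_assoc d fold2 c)
  have XA: "?X * (P * Q) = mink_G n * (mat_adjoint Q * (R * Q))"
    by (simp add: mat_assoc d fold1 c)
  show ?thesis
  proof (rule mink_inv_eqI)
    show "P * Q \<in> carrier_mat n n" "?X \<in> carrier_mat n n" using d by (auto intro!: carrier_matI)
    show "P * Q * ?X * (P * Q) = P * Q"
      unfolding AX by (simp add: mat_assoc d fold1 c)
    show "?X * (P * Q) * ?X = ?X"
      unfolding XA by (simp add: mat_assoc d fold2 c)
    show "mink_adj (P * Q * ?X) = P * Q * ?X"
      unfolding AX by (simp add: mink_adj_def mat_adjoint_mult mat_assoc d hN)
    show "mink_adj (?X * (P * Q)) = ?X * (P * Q)"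
      unfolding XA by (simp add: mink_adj_def mat_adjoint_mult mat_assoc d hN)
  qed
qed

subsection \<open>Block matrices and the rank equation\<close>

lemma four_block_mat_inj:
  assumes "A1 \<in> carrier_mat nr1 nc1" "B1 \<in> carrier_mat nr1 nc2"
    "C1 \<in> carrier_mat nr2 nc1" "D1 \<in> carrier_mat nr2 nc2"
    and "A2 \<in> carrier_mat nr1 nc1" "B2 \<in> carrier_mat nr1 nc2"
    "C2 \<in> carrier_mat nr2 nc1" "D2 \<in> carrier_mat nr2 nc2"
    and eq: "four_block_mat A1 B1 C1 D1 = four_block_mat A2 B2 C2 D2"
  shows "A1 = A2" "B1 = B2" "C1 = C2" "D1 = D2"
proof -
  note ix = arg_cong[OF eq, of "\<lambda>M. M $$ (i, j)" for i j]
  show "A1 = A2"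
  proof (rule eq_matI)
    fix i j assume "i < dim_row A2" "j < dim_col A2"
    thus "A1 $$ (i, j) = A2 $$ (i, j)" using ix[of i j] assms(1-8) by auto
  qed (use assms in auto)
  show "B1 = B2"
  proof (rule eq_matI)
    fix i j assume "i < dim_row B2" "j < dim_col B2"
    thus "B1 $$ (i, j) = B2 $$ (i, j)" using ix[of i "nc1 + j"] assms(1-8) by auto
  qed (use assms in auto)
  show "C1 = C2"
  proof (rule eq_matI)
    fix i j assume "i < dim_row C2" "j < dim_col C2"
    thus "C1 $$ (i, j) = C2 $$ (i, j)" using ix[of "nr1 + i" j] assms(1-8) by auto
  qed (use assms in auto)
  show "D1 = D2"
  proof (rule eq_matI)
    fix i j assume "i < dim_row D2" "j < dim_col D2"
    thus "D1 $$ (i, j) = D2 $$ (i, j)" using ix[of "nr1 + i" "nc1 + j"] assms(1-8) by auto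
  qed (use assms in auto)
qed

text \<open>A factorization of the whole block matrix restricts to a second factorization
  \<open>F1 * H1\<close> of \<open>P * Q\<close>. Two full-rank factorizations differ by an
  invertible change of basis, which is then absorbed into \<open>b\<close> and
  \<open>c\<close>.\<close>

lemma crank_four_block_iff:
  fixes P Q Pl Qr :: "complex mat"
  assumes P: "P \<in> carrier_mat m r" and Q: "Q \<in> carrier_mat r n"
    and Pl: "Pl \<in> carrier_mat r m" and Qr: "Qr \<in> carrier_mat n r"
    and PlP: "Pl * P = 1\<^sub>m r" and QQr: "Q * Qr = 1\<^sub>m r"
    and B: "B \<in> carrier_mat m q" and C: "C \<in> carrier_mat p n" and X: "X \<in> carrier_mat p q"
  shows "crank (four_block_mat (P * Q) B C X) \<le> r \<longleftrightarrow>
    (\<exists>b c. b \<in> carrier_mat r q \<and> c \<in> carrier_mat p r \<and> B = P * b \<and> C = c * Q \<and> X = c * b)"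
    (is "?L \<longleftrightarrow> ?R")
proof
  assume ?L
  then obtain F H where F: "F \<in> carrier_mat (m + p) r" and H: "H \<in> carrier_mat r (n + q)"
    and FH: "four_block_mat (P * Q) B C X = F * H"
    using crank_le_iff[of "four_block_mat (P * Q) B C X" "m + p" "n + q" r] P Q B C X by auto
  obtain F1 z1 F2 z2 where sF: "split_block F m r = (F1, z1, F2, z2)" by (metis prod_cases4)
  have F': "F1 \<in> carrier_mat m r" "F2 \<in> carrier_mat p r" "z1 \<in> carrier_mat m 0" "z2 \<in> carrier_mat p 0"
    "F = four_block_mat F1 z1 F2 z2"
    using split_block[OF sF, of p 0] F by auto
  obtain H1 H2 z3 z4 where sH: "split_block H r n = (H1, H2, z3, z4)" by (metis prod_cases4)
  have H': "H1 \<in> carrier_mat r n" "H2 \<in> carrier_mat r q" "z3 \<in> carrier_mat 0 n" "z4 \<in> carrier_mat 0 q"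
    "H = four_block_mat H1 H2 z3 z4"
    using split_block[OF sH, of 0 q] H by auto
  \<comment> \<open>The splits of \<open>F\<close> and \<open>H\<close> leave blocks with no columns
    or no rows; their products are empty sums and contribute nothing.\<close>
  have z: "Z * W = 0\<^sub>m (dim_row Z) (dim_col W)" if "dim_col Z = 0" "dim_row W = 0" for Z W :: "complex mat"
    using that by (intro eq_matI) (auto simp: scalar_prod_def)
  have "F * H = four_block_mat (F1 * H1) (F1 * H2) (F2 * H1) (F2 * H2)"
    unfolding F'(5) H'(5) by (subst mult_four_block_mat[OF F'(1,3,2,4) H'(1-4)]) (use F' H' z in auto)
  hence eq: "four_block_mat (P * Q) B C X = four_block_mat (F1 * H1) (F1 * H2) (F2 * H1) (F2 * H2)"
    using FH by simp
  have blocks: "P * Q = F1 * H1" "B = F1 * H2" "C = F2 * H1" "X = F2 * H2"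
    using four_block_mat_inj[OF mult_carrier_mat[OF P Q] B C X mult_carrier_mat[OF F'(1) H'(1)]
        mult_carrier_mat[OF F'(1) H'(2)] mult_carrier_mat[OF F'(2) H'(1)]
        mult_carrier_mat[OF F'(2) H'(2)] eq] .
  have d: "dim_row P = m" "dim_col P = r" "dim_row Q = r" "dim_col Q = n"
    "dim_row Pl = r" "dim_col Pl = m" "dim_row Qr = n" "dim_col Qr = r"
    "dim_row F1 = m" "dim_col F1 = r" "dim_row F2 = p" "dim_col F2 = r"
    "dim_row H1 = r" "dim_col H1 = n" "dim_row H2 = r" "dim_col H2 = q"
    using P Q Pl Qr F' H' by auto
  \<comment> \<open>\<open>W\<close> expresses \<open>F1\<close> in terms of \<open>P\<close>, and
    \<open>V\<close> expresses \<open>H1\<close> in terms of \<open>Q\<close>. They are mutually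
    inverse because \<open>F1 * H1 = P * Q\<close>.\<close>
  define W where "W = Pl * F1"
  define V where "V = H1 * Qr"
  have W: "W \<in> carrier_mat r r" and V: "V \<in> carrier_mat r r" by (auto simp: W_def V_def d)
  have "W * V = Pl * (F1 * H1) * Qr" by (simp add: W_def V_def mat_assoc d)
  also have "\<dots> = (Pl * P) * (Q * Qr)" by (simp add: blocks(1)[symmetric] mat_assoc d)
  finally have WV: "W * V = 1\<^sub>m r" by (simp add: PlP QQr)
  have VW: "V * W = 1\<^sub>m r" by (rule mat_mult_left_right_inverse[OF W V WV])
  have "F1 = F1 * (V * W)" by (simp add: VW mat_assoc d)
  also have "\<dots> = (F1 * H1) * (Qr * W)" by (simp add: V_def mat_assoc d W_def)
  also have "\<dots> = P * ((Q * Qr) * W)" by (simp add: blocks(1)[symmetric] mat_assoc d W_def)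
  finally have F1: "F1 = P * W" by (simp add: QQr mat_assoc d W_def)
  have "H1 = (V * W) * H1" by (simp add: VW mat_assoc d)
  also have "\<dots> = V * (Pl * (F1 * H1))" by (simp add: W_def mat_assoc d V_def)
  also have "\<dots> = V * ((Pl * P) * Q)" by (simp add: blocks(1)[symmetric] mat_assoc d)
  finally have H1: "H1 = V * Q" by (simp add: PlP mat_assoc d)
  have dWV: "dim_row W = r" "dim_col W = r" "dim_row V = r" "dim_col V = r" using W V by auto
  \<comment> \<open>Inserting \<open>V * W\<close> between the factors of \<open>X\<close> reveals
    the witnesses \<open>c = F2 * V\<close> and \<open>b = W * H2\<close>.\<close>
  have "X = F2 * ((V * W) * H2)" by (simp add: VW mat_assoc d blocks)
  hence "X = (F2 * V) * (W * H2)" by (simp add: mat_assoc d dWV)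
  moreover have "B = P * (W * H2)" using blocks(2) F1 by (simp add: mat_assoc d dWV)
  moreover have "C = (F2 * V) * Q" using blocks(3) H1 by (simp add: mat_assoc d dWV)
  ultimately show ?R using F' H' W V
    by (intro exI[of _ "W * H2"] exI[of _ "F2 * V"]) auto
next
  assume ?R
  then obtain b c where bc: "b \<in> carrier_mat r q" "c \<in> carrier_mat p r" "B = P * b" "C = c * Q" "X = c * b"
    by blast
  \<comment> \<open>The block matrix is the column of \<open>P\<close> and \<open>c\<close> times
    the row of \<open>Q\<close> and \<open>b\<close>.\<close>
  let ?F = "four_block_mat P (0\<^sub>m m 0) c (0\<^sub>m p 0)"
  let ?H = "four_block_mat Q b (0\<^sub>m 0 n) (0\<^sub>m 0 q)"
  have "?F * ?H = four_block_mat (P * Q) B C X"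
    using P Q bc by (subst mult_four_block_mat[of _ m r _ 0 _ p _ _ n _ q]) auto
  moreover have "?F \<in> carrier_mat (m + p) r" "?H \<in> carrier_mat r (n + q)"
    using P Q bc four_block_carrier_mat[of P m r "0\<^sub>m p 0" p 0]
      four_block_carrier_mat[of Q r n "0\<^sub>m 0 q" 0 q] by auto
  ultimately show ?L using crank_mult_le by metis
qed

section \<open>Concatenated blocks: products, adjoints and splitting\<close>

lemma dim_hcat [simp]: "dim_row (hcat P Q) = dim_row P" "dim_col (hcat P Q) = dim_col P + dim_col Q"
  by (simp_all add: hcat_def)

lemma dim_vcat [simp]: "dim_row (vcat P Q) = dim_row P + dim_row Q" "dim_col (vcat P Q) = dim_col P"
  by (simp_all add: vcat_def)

lemma hcat_carrier [simp]:
  assumes "P \<in> carrier_mat a b" "Q \<in> carrier_mat a c"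
  shows "hcat P Q \<in> carrier_mat a (b + c)"
  using assms by (intro carrier_matI) simp_all

lemma vcat_carrier [simp]:
  assumes "P \<in> carrier_mat a c" "Q \<in> carrier_mat b c"
  shows "vcat P Q \<in> carrier_mat (a + b) c"
  using assms by (intro carrier_matI) simp_all

lemma mult_hcat:
  assumes "M \<in> carrier_mat m a" "P \<in> carrier_mat a b" "Q \<in> carrier_mat a c"
  shows "M * hcat P Q = hcat (M * P) (M * Q)"
proof -
  \<comment> \<open>Empty blocks bring \<open>M\<close> into the shape required by the product rule
    for four-block matrices.\<close>
  have M: "M = four_block_mat M (0\<^sub>m m 0) (0\<^sub>m 0 a) (0\<^sub>m 0 0)"
    using assms by (intro eq_matI) auto
  show ?thesis unfolding hcat_def
    by (subst M, subst mult_four_block_mat[of _ m a _ 0 _ 0 _ _ b _ c]) (use assms in auto)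
qed

lemma vcat_mult:
  assumes "P \<in> carrier_mat a c" "Q \<in> carrier_mat b c" "M \<in> carrier_mat c m"
  shows "vcat P Q * M = vcat (P * M) (Q * M)"
proof -
  have M: "M = four_block_mat M (0\<^sub>m c 0) (0\<^sub>m 0 m) (0\<^sub>m 0 0)"
    using assms by (intro eq_matI) auto
  show ?thesis unfolding vcat_def
    by (subst M, subst mult_four_block_mat[of _ a c _ 0 _ b _ _ m _ 0]) (use assms in auto)
qed

lemma vcat_mult_hcat:
  assumes "P \<in> carrier_mat a c" "Q \<in> carrier_mat b c" "R \<in> carrier_mat c d" "S \<in> carrier_mat c e"
  shows "vcat P Q * hcat R S = four_block_mat (P * R) (P * S) (Q * R) (Q * S)"
  unfolding hcat_def vcat_def
  by (subst mult_four_block_mat[of _ a c _ 0 _ b _ _ d _ e]) (use assms in auto)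

lemma hcat_mult_vcat:
  assumes "P \<in> carrier_mat a c" "Q \<in> carrier_mat a d" "R \<in> carrier_mat c b" "S \<in> carrier_mat d b"
  shows "hcat P Q * vcat R S = P * R + Q * S"
proof -
  have "hcat P Q * vcat R S = four_block_mat (P * R + Q * S) (0\<^sub>m a 0) (0\<^sub>m 0 b) (0\<^sub>m 0 0)"
    unfolding hcat_def vcat_def
    by (subst mult_four_block_mat[of _ a c _ d _ 0 _ _ b _ 0]) (use assms in auto)
  also have "\<dots> = P * R + Q * S" using assms by (intro eq_matI) auto
  finally show ?thesis .
qed

lemma mat_adjoint_hcat:
  assumes "dim_row P = dim_row Q"
  shows "mat_adjoint (hcat P Q) = vcat (mat_adjoint P) (mat_adjoint Q)"
  using assms by (intro eq_matI) (auto simp: mat_adjoint_eq hcat_def vcat_def)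

lemma mat_adjoint_vcat:
  assumes "dim_col P = dim_col Q"
  shows "mat_adjoint (vcat P Q) = hcat (mat_adjoint P) (mat_adjoint Q)"
  using assms by (intro eq_matI) (auto simp: mat_adjoint_eq hcat_def vcat_def)

lemma obtain_vcat:
  assumes "M \<in> carrier_mat (a + b) c"
  obtains P Q where "P \<in> carrier_mat a c" "Q \<in> carrier_mat b c" "M = vcat P Q"
proof -
  obtain P z Q z' where s: "split_block M a c = (P, z, Q, z')" by (metis prod_cases4)
  have b: "P \<in> carrier_mat a c" "z \<in> carrier_mat a 0" "Q \<in> carrier_mat b c" "z' \<in> carrier_mat b 0"
    "M = four_block_mat P z Q z'"
    using split_block[OF s, of b 0] assms by auto
  have "M = vcat P Q" unfolding b(5) vcat_def using b(1-4) by (intro eq_matI) auto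
  thus ?thesis using that b by blast
qed

lemma obtain_hcat:
  assumes "M \<in> carrier_mat c (a + b)"
  obtains P Q where "P \<in> carrier_mat c a" "Q \<in> carrier_mat c b" "M = hcat P Q"
proof -
  obtain P Q z z' where s: "split_block M c a = (P, Q, z, z')" by (metis prod_cases4)
  have b: "P \<in> carrier_mat c a" "Q \<in> carrier_mat c b" "z \<in> carrier_mat 0 a" "z' \<in> carrier_mat 0 b"
    "M = four_block_mat P Q z z'"
    using split_block[OF s, of 0 b] assms by auto
  have "M = hcat P Q" unfolding b(5) hcat_def using b(1-4) by (intro eq_matI) auto
  thus ?thesis using that b by blast
qed

lemma hcat_inj:
  assumes "P \<in> carrier_mat c a" "Q \<in> carrier_mat c b" "P' \<in> carrier_mat c a" "Q' \<in> carrier_mat c b"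
    and "hcat P Q = hcat P' Q'"
  shows "P = P'" "Q = Q'"
  using four_block_mat_inj[of P c a Q b "0\<^sub>m 0 a" 0 "0\<^sub>m 0 b" P' Q' "0\<^sub>m 0 a" "0\<^sub>m 0 b"] assms
  by (auto simp: hcat_def)

text \<open>\<open>V\<close> embeds the first \<open>a\<close> coordinates, so the leading block is
  a compression by \<open>V\<close>. This identifies \<open>G1\<close> with the Gram matrix of
  \<open>P = U * V\<close>.\<close>

lemma fst_split_block:
  assumes "M \<in> carrier_mat (a + b) (a + b)"
  defines "V \<equiv> vcat (1\<^sub>m a) (0\<^sub>m b a)"
  shows "fst (split_block M a a) = mat_adjoint V * (M * V)"
proof -
  obtain M1 M2 M3 M4 where s: "split_block M a a = (M1, M2, M3, M4)" by (metis prod_cases4)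
  have b: "M1 \<in> carrier_mat a a" "M2 \<in> carrier_mat a b" "M3 \<in> carrier_mat b a" "M4 \<in> carrier_mat b b"
    "M = four_block_mat M1 M2 M3 M4"
    using split_block[OF s, of b b] assms(1) by auto
  have z: "mat_adjoint (0\<^sub>m b a :: complex mat) = 0\<^sub>m a b" by (rule eq_matI) (auto simp: mat_adjoint_eq)
  have "M * V = vcat M1 M3"
    unfolding V_def vcat_def b(5)
    by (subst mult_four_block_mat[of _ a a _ b _ b _ _ a _ 0]) (use b(1-4) in auto)
  hence "mat_adjoint V * (M * V) = M1"
    using b(1-4) by (simp add: V_def mat_adjoint_vcat z) (subst hcat_mult_vcat[of _ a a _ b _ a]; simp)
  thus ?thesis by (simp add: s)
qed

text \<open>The selectors \<open>E = (I 0)\<close> and \<open>E'\<close>, a column of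
  \<open>I\<close> over 0, cut \<open>A\<close> out of the block matrix, so any factorization of the
  latter gives one of \<open>A\<close> with the same inner dimension. With the bound from
  \<open>crank_four_block_iff\<close> this yields equality of ranks.\<close>

lemma crank_four_block_ge:
  assumes A: "A \<in> carrier_mat m n" and B: "B \<in> carrier_mat m q" and C: "C \<in> carrier_mat p n"
    and X: "X \<in> carrier_mat p q"
  shows "crank A \<le> crank (four_block_mat A B C X)"
proof -
  let ?M = "four_block_mat A B C X"
  have M: "?M \<in> carrier_mat (m + p) (n + q)" using A X by simp
  define E where "E = four_block_mat (1\<^sub>m m) (0\<^sub>m m p) (0\<^sub>m 0 m) (0\<^sub>m 0 p :: complex mat)"
  define E' where "E' = four_block_mat (1\<^sub>m n) (0\<^sub>m n 0) (0\<^sub>m q n) (0\<^sub>m q 0 :: complex mat)"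
  have d: "dim_row E = m" "dim_col E = m + p" "dim_row E' = n + q" "dim_col E' = n"
    by (auto simp: E_def E'_def)
  have "?M * E' = four_block_mat A (0\<^sub>m m 0) C (0\<^sub>m p 0)"
    unfolding E'_def by (subst mult_four_block_mat[of _ m n _ q _ p _ _ n _ 0]) (use assms in auto)
  hence "E * (?M * E') = four_block_mat A (0\<^sub>m m 0) (0\<^sub>m 0 n) (0\<^sub>m 0 0)"
    unfolding E_def by (simp, subst mult_four_block_mat[of _ m m _ p _ 0 _ _ n _ 0]) (use assms in auto)
  also have "\<dots> = A" using A by (intro eq_matI) auto
  finally have A': "A = E * (?M * E')" ..
  obtain F H where F: "F \<in> carrier_mat (m + p) (crank ?M)" and H: "H \<in> carrier_mat (crank ?M) (n + q)"
    and FH: "?M = F * H"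
    by (rule crank_factorization[OF M])
  have dF: "dim_row F = m + p" "dim_col F = crank ?M" "dim_row H = crank ?M" "dim_col H = n + q"
    using F H by auto
  have eq: "A = (E * F) * (H * E')" by (subst A', subst FH) (simp add: mat_assoc d dF)
  have "E * F \<in> carrier_mat m (crank ?M)" "H * E' \<in> carrier_mat (crank ?M) n"
    by (auto intro!: carrier_matI simp: d dF)
  hence "crank (E * F * (H * E')) \<le> crank ?M" by (rule crank_mult_le)
  thus ?thesis using eq by simp
qed

section \<open>Nonsingular factors and uniqueness in the rank equation\<close>

lemma inverse_of_det_nonzero:
  fixes M :: "complex mat"
  assumes M: "M \<in> carrier_mat k k" and det: "det M \<noteq> 0"
  obtains N where "N \<in> carrier_mat k k" "M * N = 1\<^sub>m k" "N * M = 1\<^sub>m k"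
  using det_non_zero_imp_unit[OF M det, of "()"] that
  by (auto simp: Units_def ring_mat_def)

text \<open>A singular \<open>M\<close> factors through fewer than \<open>r\<close> dimensions, and
  so would the whole product. This is how the rank hypothesis becomes invertibility.\<close>

lemma det_nonzero_of_crank_ge:
  assumes F: "F \<in> carrier_mat m r" and M: "M \<in> carrier_mat r r" and H: "H \<in> carrier_mat r q"
    and rank: "r \<le> crank (F * M * H)"
  shows "det M \<noteq> 0"
proof
  assume "det M = 0"
  hence lt: "crank M < r" using vec_space.det_zero_low_rank[OF M] M by simp
  obtain F' H' where F': "F' \<in> carrier_mat r (crank M)" and H': "H' \<in> carrier_mat (crank M) r"
    and FH: "M = F' * H'"
    by (rule crank_factorization[OF M])
  define k where "k = crank M"
  have d: "dim_row F = m" "dim_col F = r" "dim_row H = r" "dim_col H = q" "dim_row F' = r" "dim_col F' = k"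
    "dim_row H' = k" "dim_col H' = r"
    using F H F' H' unfolding k_def by auto
  have "F * M * H = (F * F') * (H' * H)" unfolding FH by (simp add: mat_assoc d)
  moreover have "F * F' \<in> carrier_mat m k" "H' * H \<in> carrier_mat k q" "F * M * H \<in> carrier_mat m q"
    using F H M by (auto intro!: carrier_matI simp: d)
  ultimately have "crank (F * M * H) \<le> k" using crank_mult_le by metis
  thus False using rank lt k_def by simp
qed

text \<open>The one-sided inverses \<open>Pl\<close> and \<open>Qr\<close> make \<open>b\<close> and
  \<open>c\<close> unique for given \<open>B\<close> and \<open>C\<close>. Hence
  \<open>c * b\<close> is the only completion of rank \<open>r\<close>, and the claim becomes
  \<open>Z = c * b\<close>.\<close>

lemma rank_equation_iff:
  assumes P: "P \<in> carrier_mat m r" and Q: "Q \<in> carrier_mat r n"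
    and Pl: "Pl \<in> carrier_mat r m" and Qr: "Qr \<in> carrier_mat n r"
    and PlP: "Pl * P = 1\<^sub>m r" and QQr: "Q * Qr = 1\<^sub>m r" and rank: "crank (P * Q) = r"
    and B: "B \<in> carrier_mat m q" and C: "C \<in> carrier_mat p n" and Z: "Z \<in> carrier_mat p q"
  shows "(\<forall>X \<in> carrier_mat p q. crank (four_block_mat (P * Q) B C X) = r \<longleftrightarrow> X = Z) \<longleftrightarrow>
    (\<exists>b c. b \<in> carrier_mat r q \<and> c \<in> carrier_mat p r \<and> B = P * b \<and> C = c * Q \<and> Z = c * b)"
    (is "?L \<longleftrightarrow> ?R")
proof -
  have d: "dim_row P = m" "dim_col P = r" "dim_row Q = r" "dim_col Q = n"
    "dim_row Pl = r" "dim_col Pl = m" "dim_row Qr = n" "dim_col Qr = r"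
    using P Q Pl Qr by auto
  have iff: "crank (four_block_mat (P * Q) B C X) = r \<longleftrightarrow>
    (\<exists>b c. b \<in> carrier_mat r q \<and> c \<in> carrier_mat p r \<and> B = P * b \<and> C = c * Q \<and> X = c * b)"
    if X: "X \<in> carrier_mat p q" for X
    using crank_four_block_iff[OF P Q Pl Qr PlP QQr B C X]
      crank_four_block_ge[OF mult_carrier_mat[OF P Q] B C X] rank by auto
  have unique: "b = b'" "c = c'"
    if bc: "b \<in> carrier_mat r q" "c \<in> carrier_mat p r" "b' \<in> carrier_mat r q" "c' \<in> carrier_mat p r"
      and eq: "P * b = P * b'" "c * Q = c' * Q" for b c b' c'
  proof -
    have dd: "dim_row b = r" "dim_row b' = r" "dim_col c = r" "dim_col c' = r" using bc by auto
    show "b = b'" using arg_cong[OF eq(1), of "\<lambda>M. Pl * M"] 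
      by (simp add: mat_mult_cancel[OF PlP] mat_assoc d dd)
    show "c = c'" using arg_cong[OF eq(2), of "\<lambda>M. M * Qr"]
      by (simp add: QQr mat_assoc d dd)
  qed
  show ?thesis
  proof
    assume ?L
    thus ?R using iff[OF Z] Z by blast
  next
    assume R: ?R
    show ?L
    proof
      fix X :: "complex mat" assume X: "X \<in> carrier_mat p q"
      show "crank (four_block_mat (P * Q) B C X) = r \<longleftrightarrow> X = Z"
        unfolding iff[OF X] using R by (auto dest: unique)
    qed
  qed
qed

subsection \<open>The factor equation\<close>

text \<open>The columns of $I - T^{(1)*}T^*$ lie in $\mathcal{N}(T^*)$, so the kernel inclusion can be used
  without any duality or dimension argument.\<close>
lemma kernel_subset_factor:
  fixes T W :: "complex mat"
  assumes T: "T \<in> carrier_mat n m" and W: "W \<in> carrier_mat k n" and T1: "T1 \<in> carrier_mat m n"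
    and inner: "T * T1 * T = T" and ker: "mat_kernel (mat_adjoint T) \<subseteq> mat_kernel W"
  shows "W = W * (mat_adjoint T1 * mat_adjoint T)"
proof -
  have d: "dim_row T = n" "dim_col T = m" "dim_row W = k" "dim_col W = n" "dim_row T1 = m" "dim_col T1 = n"
    using T W T1 by auto
  define E where "E = mat_adjoint T1 * mat_adjoint T"
  define D where "D = 1\<^sub>m n - E"
  have E: "E \<in> carrier_mat n n" by (rule carrier_matI) (simp_all add: E_def d)
  have D: "D \<in> carrier_mat n n" unfolding D_def using E by (intro minus_carrier_mat)
  have aT: "mat_adjoint T \<in> carrier_mat m n" by (rule carrier_matI) (simp_all add: d)
  have "mat_adjoint T * E = mat_adjoint T"
    using arg_cong[OF inner, of mat_adjoint] by (simp add: E_def mat_adjoint_mult mat_assoc d)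
  hence TD: "mat_adjoint T * D = 0\<^sub>m m n"
    unfolding D_def using aT E by (simp add: mult_minus_distrib_mat[of _ m n _ n] mat_assoc d)
  have "W * D = 0\<^sub>m k n"
  proof (rule mat_col_eqI)
    fix j assume "j < dim_col (0\<^sub>m k n :: complex mat)"
    hence j: "j < n" by simp
    have "mat_adjoint T *\<^sub>v col D j = 0\<^sub>v m"
      using col_mult2[OF aT D j] TD j by simp
    hence "col D j \<in> mat_kernel (mat_adjoint T)"
      using mat_kernelI[OF aT, of "col D j"] D j by simp
    hence "W *\<^sub>v col D j = 0\<^sub>v k" using ker mat_kernelD(2)[OF W] by blast
    thus "col (W * D) j = col (0\<^sub>m k n) j" using col_mult2[OF W D j] j by simp
  qed (use W D in auto)
  hence z: "W - W * E = 0\<^sub>m k n"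
    unfolding D_def using W E by (simp add: mult_minus_distrib_mat[of _ k n _ n] mat_assoc d)
  have "W = W * E"
  proof (rule eq_matI)
    fix i j assume ij: "i < dim_row (W * E)" "j < dim_col (W * E)"
    thus "W $$ (i, j) = (W * E) $$ (i, j)"
      using arg_cong[OF z, of "\<lambda>M. M $$ (i, j)"] W E by simp
  qed (use W E in auto)
  thus ?thesis by (simp add: E_def)
qed

text \<open>The equation forces \<open>W * J\<close> to be invertible, which gives \<open>J\<close>
  the explicit left inverse \<open>B1 * (Mi * W)\<close>. Composed with the right inverse
  \<open>Sr\<close> of \<open>S\<close>, it is an inner inverse of \<open>J * S\<close> that
  recovers \<open>B1\<close> with no free parameter.\<close>

lemma factor_equation_imp:
  fixes J S Sr W M Mi B1 :: "complex mat"
  assumes J: "J \<in> carrier_mat n r" and S: "S \<in> carrier_mat r n" and Sr: "Sr \<in> carrier_mat n r"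
    and W: "W \<in> carrier_mat r n" and M: "M \<in> carrier_mat r r" and Mi: "Mi \<in> carrier_mat r r"
    and B1: "B1 \<in> carrier_mat r r"
    and SSr: "S * Sr = 1\<^sub>m r" and WW: "W * mat_adjoint W = 1\<^sub>m r" and MMi: "M * Mi = 1\<^sub>m r"
    and eq: "J * B1 = mat_adjoint W * M"
  shows "(B1 * (Mi * W)) * J = 1\<^sub>m r"
    and "mat_kernel (mat_adjoint (J * S)) \<subseteq> mat_kernel W"
    and "J * S * (Sr * (B1 * (Mi * W))) * (J * S) = J * S"
    and "S * (Sr * (B1 * (Mi * W)) * (mat_adjoint W * M)) = B1"
proof -
  have d: "dim_row J = n" "dim_col J = r" "dim_row S = r" "dim_col S = n" "dim_row Sr = n" "dim_col Sr = r"
    "dim_row W = r" "dim_col W = n" "dim_row M = r" "dim_col M = r" "dim_row Mi = r" "dim_col Mi = r"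
    "dim_row B1 = r" "dim_col B1 = r"
    using J S Sr W M Mi B1 by auto
  have MiM: "Mi * M = 1\<^sub>m r" by (rule mat_mult_left_right_inverse[OF M Mi MMi])
  have JZ: "J * (B1 * Mi) = mat_adjoint W"
    using arg_cong[OF eq, of "\<lambda>X. X * Mi"] by (simp add: mat_assoc d MMi)
  have "(W * J) * (B1 * Mi) = 1\<^sub>m r" using WW JZ by (simp add: mat_assoc d)
  hence "(B1 * Mi) * (W * J) = 1\<^sub>m r"
    by (intro mat_mult_left_right_inverse[of "W * J" r "B1 * Mi"]) (auto intro!: carrier_matI simp: d)
  thus left: "(B1 * (Mi * W)) * J = 1\<^sub>m r" by (simp add: mat_assoc d)
  have left': "B1 * (Mi * (W * (J * Z))) = Z" if "dim_row Z = r" for Z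
    using mat_mult_cancel[OF left, of Z] that by (simp add: mat_assoc d)
  have SSr': "S * (Sr * Z) = Z" if "dim_row Z = r" for Z
    using mat_mult_cancel[OF SSr, of Z] that by (simp add: mat_assoc d)
  have WW': "W * (mat_adjoint W * Z) = Z" if "dim_row Z = r" for Z
    using mat_mult_cancel[OF WW, of Z] that by (simp add: mat_assoc d)
  show "J * S * (Sr * (B1 * (Mi * W))) * (J * S) = J * S"
    by (simp add: mat_assoc d SSr' left')
  show "S * (Sr * (B1 * (Mi * W)) * (mat_adjoint W * M)) = B1"
    by (simp add: mat_assoc d SSr' WW' MiM)
  \<comment> \<open>A kernel inclusion follows once \<open>W\<close> is a left multiple of the
    adjoint of \<open>J * S\<close>. Inserting \<open>S * Sr\<close> into the adjoint of
    \<open>JZ\<close> exhibits this multiple.\<close>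
  have "W = mat_adjoint (J * (S * (Sr * (B1 * Mi))))"
    using JZ by (simp add: SSr' d)
  also have "\<dots> = mat_adjoint (Sr * (B1 * Mi)) * mat_adjoint (J * S)"
    by (simp add: mat_adjoint_mult mat_assoc d)
  finally have fac: "W = mat_adjoint (Sr * (B1 * Mi)) * mat_adjoint (J * S)" .
  show "mat_kernel (mat_adjoint (J * S)) \<subseteq> mat_kernel W"
    using mat_kernel_mult_subset[of "mat_adjoint (J * S)" n n "mat_adjoint (Sr * (B1 * Mi))" r]
    by (simp add: carrier_matI d flip: fac)
qed

text \<open>The kernel inclusion gives \<open>mat_adjoint W = J * Z\<close> with
  \<open>Z = S * (T1 * mat_adjoint W)\<close>, so \<open>Z * W\<close> is a left inverse of
  \<open>J\<close>. Cancelling \<open>J\<close> and \<open>S\<close> in the inner-inverse identity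
  leaves \<open>S * (T1 * J) = 1\<close>, and this annihilates the terms with \<open>Y1\<close> and
  \<open>Y2\<close>.\<close>

lemma factor_equation_of_param:
  fixes J S Sr W M Mi T1 :: "complex mat"
  assumes J: "J \<in> carrier_mat n r" and S: "S \<in> carrier_mat r n" and Sr: "Sr \<in> carrier_mat n r"
    and W: "W \<in> carrier_mat r n" and M: "M \<in> carrier_mat r r"
    and Y1: "Y1 \<in> carrier_mat n r" and Y2: "Y2 \<in> carrier_mat n q" and T1: "T1 \<in> carrier_mat n n"
    and SSr: "S * Sr = 1\<^sub>m r" and WW: "W * mat_adjoint W = 1\<^sub>m r"
    and ker: "mat_kernel (mat_adjoint (J * S)) \<subseteq> mat_kernel W"
    and inner: "J * S * T1 * (J * S) = J * S"
  shows "J * (S * (T1 * (mat_adjoint W * M) + (1\<^sub>m n - T1 * (J * S)) * Y1)) = mat_adjoint W * M"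
    and "S * ((1\<^sub>m n - T1 * (J * S)) * Y2) = 0\<^sub>m r q"
proof -
  have d: "dim_row J = n" "dim_col J = r" "dim_row S = r" "dim_col S = n" "dim_row Sr = n" "dim_col Sr = r"
    "dim_row W = r" "dim_col W = n" "dim_row M = r" "dim_col M = r"
    "dim_row Y1 = n" "dim_col Y1 = r" "dim_row Y2 = n" "dim_col Y2 = q" "dim_row T1 = n" "dim_col T1 = n"
    using J S Sr W M Y1 Y2 T1 by auto
  have "W = W * (mat_adjoint T1 * mat_adjoint (J * S))"
    by (rule kernel_subset_factor[OF mult_carrier_mat[OF J S] W T1 inner ker])
  hence "mat_adjoint W = mat_adjoint (W * (mat_adjoint T1 * mat_adjoint (J * S)))" by (rule arg_cong)
  also have "\<dots> = J * (S * (T1 * mat_adjoint W))"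
    by (simp add: mat_adjoint_mult mat_assoc d)
  finally have aW: "mat_adjoint W = J * (S * (T1 * mat_adjoint W))" .
  define Z where "Z = S * (T1 * mat_adjoint W)"
  have Z: "dim_row Z = r" "dim_col Z = r" by (simp_all add: Z_def d)
  have JZ: "mat_adjoint W = J * Z" using aW unfolding Z_def .
  have "(W * J) * Z = 1\<^sub>m r" using WW by (simp add: JZ mat_assoc d Z)
  hence ZWJ: "Z * (W * J) = 1\<^sub>m r"
    by (intro mat_mult_left_right_inverse[of "W * J" r Z]) (auto intro!: carrier_matI simp: d Z)
  have cancel: "Z * (W * (J * X)) = X" if "dim_row X = r" for X
    using mat_mult_cancel[OF ZWJ, of X] that by (simp add: mat_assoc d Z)
  \<comment> \<open>Multiplication by \<open>Sr\<close> on the right removes \<open>S\<close>;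
    afterwards \<open>Z * W\<close> on the left removes \<open>J\<close>.\<close>
  have "J * (S * (T1 * (J * (S * Sr)))) = J * (S * Sr)"
    using arg_cong[OF inner, of "\<lambda>X. X * Sr"] by (simp add: mat_assoc d)
  hence "J * (S * (T1 * J)) = J" by (simp add: mat_assoc d SSr)
  from arg_cong[OF this, of "\<lambda>X. Z * (W * X)"] have STJ: "S * (T1 * J) = 1\<^sub>m r"
    by (simp add: cancel d) (use ZWJ in simp)
  have "S * (1\<^sub>m n - T1 * (J * S)) = S - S * (T1 * J) * S"
    by (subst mult_minus_distrib_mat[of _ r n _ n]) (auto intro!: carrier_matI simp: d mat_assoc)
  also have "\<dots> = 0\<^sub>m r n" using S by (simp add: STJ)
  finally have z: "S * (1\<^sub>m n - T1 * (J * S)) = 0\<^sub>m r n" .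
  have z': "S * ((1\<^sub>m n - T1 * (J * S)) * Y) = 0\<^sub>m r (dim_col Y)" if "dim_row Y = n" for Y
    using mat_mult_cancel[OF z, of Y] that by (simp add: d)
  show "S * ((1\<^sub>m n - T1 * (J * S)) * Y2) = 0\<^sub>m r q" using z'[of Y2] by (simp add: d)
  have "S * (T1 * (mat_adjoint W * M) + (1\<^sub>m n - T1 * (J * S)) * Y1)
    = S * (T1 * (mat_adjoint W * M)) + 0\<^sub>m r r"
    by (subst mult_add_distrib_mat[of _ r n _ r]) (auto intro!: carrier_matI simp: d z')
  also have "\<dots> = Z * M"
    by (subst right_add_zero_mat[of _ r r]) (auto intro!: carrier_matI simp: d Z_def mat_assoc)
  finally have "S * (T1 * (mat_adjoint W * M) + (1\<^sub>m n - T1 * (J * S)) * Y1) = Z * M" .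
  moreover have "J * (Z * M) = mat_adjoint W * M" by (simp add: JZ mat_assoc d Z)
  ultimately show "J * (S * (T1 * (mat_adjoint W * M) + (1\<^sub>m n - T1 * (J * S)) * Y1)) = mat_adjoint W * M"
    by (simp only:)
qed

section \<open>The coefficient blocks for which the Minkowski inverse solves the rank
  equation\<close>

theorem theorem7p3:
  fixes n r :: nat and A U Sig K L B C :: "complex mat" and \<sigma> :: "nat \<Rightarrow> real"
  assumes A_dim: "A \<in> carrier_mat n n" and rankA: "crank A = r"
    and U_dim: "U \<in> carrier_mat n n" and U_unit: "unitary_mat U"
    and Sig_def: "Sig = mat r r (\<lambda>(i,j). if i = j then complex_of_real (\<sigma> i) else 0)"
    and \<sigma>_pos: "\<forall>i<r. \<sigma> i > 0"
    and K_dim: "K \<in> carrier_mat r r" and L_dim: "L \<in> carrier_mat r (n - r)"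
    and KL: "K * mat_adjoint K + L * mat_adjoint L = 1\<^sub>m r"
    and HS: "A = U * four_block_mat (Sig * K) (Sig * L) (0\<^sub>m (n - r) r) (0\<^sub>m (n - r) (n - r))
                 * mat_adjoint U"
    and rank_cond: "crank (mink_adj A * A * mink_adj A) = crank A"
    and B_dim: "B \<in> carrier_mat n n" and C_dim: "C \<in> carrier_mat n n"
  shows "(\<forall>X \<in> carrier_mat n n.
            (crank (four_block_mat A B C X) = crank A \<longleftrightarrow> X = mink_inv A))
     \<longleftrightarrow>
     (let GG = mat_adjoint U * mink_G n * U;
          G1 = fst (split_block GG r r);
          KLrow = hcat K L;
          Delta = KLrow * GG * mat_adjoint KLrow;
          M = inv_mat (G1 * Sig * Delta);
          SKL = hcat (Sig * K) (Sig * L)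
      in \<exists>J1 J3 Y1 Y2 T1.
           J1 \<in> carrier_mat r r \<and> J3 \<in> carrier_mat (n - r) r \<and>
           Y1 \<in> carrier_mat n r \<and> Y2 \<in> carrier_mat n (n - r) \<and>
           (let T = four_block_mat (J1 * Sig * K) (J1 * Sig * L) (J3 * Sig * K) (J3 * Sig * L)
            in mat_kernel (mat_adjoint T) \<subseteq> mat_kernel KLrow \<and>
               T1 \<in> carrier_mat n n \<and> T * T1 * T = T \<and>
               (let B1 = SKL * (T1 * vcat (mat_adjoint K * M) (mat_adjoint L * M)
                                + (1\<^sub>m n - T1 * T) * Y1);
                    B2 = SKL * ((1\<^sub>m n - T1 * T) * Y2)
                in B = U * four_block_mat B1 B2 (0\<^sub>m (n - r) r) (0\<^sub>m (n - r) (n - r))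
                         * mat_adjoint U * mink_G n \<and>
                   C = mink_G n * U * T * mat_adjoint U)))"
    (is "?L \<longleftrightarrow> ?R")
proof -
  let ?G = "mink_G n" and ?Uh = "mat_adjoint U"
  \<comment> \<open>Makes the natural-number difference \<open>n - r\<close> genuine, so that the
    block sizes add up to \<open>n\<close>.\<close>
  have rn: "r \<le> n" using vec_space.rank_le_nc[OF A_dim] rankA A_dim by simp
  hence nr [simp]: "r + (n - r) = n" by simp
  define W where "W = hcat K L"
  define S where "S = hcat (Sig * K) (Sig * L)"
  define V :: "complex mat" where "V = vcat (1\<^sub>m r) (0\<^sub>m (n - r) r)"
  define GG where "GG = ?Uh * ?G * U"
  define G1 where "G1 = fst (split_block GG r r)"
  define Delta where "Delta = W * GG * mat_adjoint W"
  define M where "M = inv_mat (G1 * Sig * Delta)"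
  \<comment> \<open>The inverse of \<open>Sig\<close>; positivity of the singular values makes the
    reciprocals meaningful.\<close>
  define Si where "Si = mat r r (\<lambda>(i,j). if i = j then complex_of_real (1 / \<sigma> i) else 0)"
  have Sig: "Sig \<in> carrier_mat r r" by (simp add: Sig_def)
  have W: "W \<in> carrier_mat r n" using hcat_carrier[OF K_dim L_dim] by (simp add: W_def)
  have V: "V \<in> carrier_mat n r"
    using vcat_carrier[of "1\<^sub>m r" r r "0\<^sub>m (n - r) r" "n - r"] by (simp add: V_def)
  have d: "dim_row A = n" "dim_col A = n" "dim_row U = n" "dim_col U = n" "dim_row B = n" "dim_col B = n"
    "dim_row C = n" "dim_col C = n" "dim_row Sig = r" "dim_col Sig = r" "dim_row K = r" "dim_col K = r"
    "dim_row L = r" "dim_col L = n - r" "dim_row W = r" "dim_col W = n" "dim_row V = n" "dim_col V = r"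
    "dim_row Si = r" "dim_col Si = r" "dim_row GG = n" "dim_col GG = n"
    "dim_row Delta = r" "dim_col Delta = r"
    using A_dim U_dim B_dim C_dim Sig K_dim L_dim W V by (auto simp: Si_def GG_def Delta_def)
  have UU: "U * ?Uh = 1\<^sub>m n" "?Uh * U = 1\<^sub>m n" using U_unit by (auto simp: unitary_mat_def d)
  have UU': "U * (?Uh * X) = X" "?Uh * (U * X) = X" if "dim_row X = n" for X
    using that mat_mult_cancel[OF UU(1), of X] mat_mult_cancel[OF UU(2), of X] by (simp_all add: mat_assoc d)
  have WW: "W * mat_adjoint W = 1\<^sub>m r"
    using hcat_mult_vcat[of K r r L "n - r" "mat_adjoint K" r "mat_adjoint L"] KL
    by (simp add: W_def mat_adjoint_hcat d carrier_matI)
  have WW': "W * (mat_adjoint W * X) = X" if "dim_row X = r" for X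
    using that mat_mult_cancel[OF WW, of X] by (simp add: mat_assoc d)
  have adjV: "mat_adjoint V = hcat (1\<^sub>m r) (0\<^sub>m r (n - r))"
    by (rule eq_matI) (auto simp: mat_adjoint_eq V_def vcat_def hcat_def)
  have VV: "mat_adjoint V * V = 1\<^sub>m r"
    unfolding adjV unfolding V_def
    by (subst hcat_mult_vcat[of _ r r _ "n - r" _ r]) auto
  have VV': "mat_adjoint V * (V * X) = X" if "dim_row X = r" for X
    using that mat_mult_cancel[OF VV, of X] by (simp add: mat_assoc d)
  have SigSi: "Sig * Si = 1\<^sub>m r"
  proof (rule eq_matI)
    fix i j assume ij: "i < dim_row (1\<^sub>m r :: complex mat)" "j < dim_col (1\<^sub>m r :: complex mat)"
    have "(Sig * Si) $$ (i, j) = (\<Sum>k<r. Sig $$ (i, k) * Si $$ (k, j))"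
      using ij by (simp add: scalar_prod_def atLeast0LessThan d)
    also have "\<dots> = (\<Sum>k<r. if k = i then (if i = j then 1 else 0) else 0)"
      using ij \<sigma>_pos by (intro sum.cong) (auto simp: Sig_def Si_def dest!: spec[of _ i])
    also have "\<dots> = 1\<^sub>m r $$ (i, j)" using ij by auto
    finally show "(Sig * Si) $$ (i, j) = 1\<^sub>m r $$ (i, j)" .
  qed (auto simp: d)
  have adjSig: "mat_adjoint Sig = Sig"
    by (rule eq_matI) (auto simp: mat_adjoint_eq Sig_def)
  have SW: "S = Sig * W" unfolding S_def W_def by (rule mult_hcat[OF Sig K_dim L_dim, symmetric])
  have S: "S \<in> carrier_mat r n" by (rule carrier_matI) (simp_all add: SW d)
  define P where "P = U * V"
  define Q where "Q = Sig * (W * ?Uh)"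
  have P: "P \<in> carrier_mat n r" and Q: "Q \<in> carrier_mat r n"
    by (auto intro!: carrier_matI simp: P_def Q_def d)
  have block_VX: "four_block_mat X1 X2 (0\<^sub>m (n - r) r) (0\<^sub>m (n - r) (n - r)) = V * hcat X1 X2"
    if "X1 \<in> carrier_mat r r" "X2 \<in> carrier_mat r (n - r)" for X1 X2
    unfolding V_def by (subst vcat_mult_hcat[of _ r r _ "n - r" _ r _ "n - r"]) (use that in auto)
  have APQ: "A = P * Q"
  proof -
    have "A = U * (V * S) * ?Uh"
      unfolding HS S_def
      by (subst block_VX[OF mult_carrier_mat[OF Sig K_dim] mult_carrier_mat[OF Sig L_dim]]) (rule refl)
    also have "\<dots> = P * Q" by (simp add: P_def Q_def SW mat_assoc d)
    finally show ?thesis .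
  qed

  define N1 where "N1 = mat_adjoint P * (?G * P)"
  define R1 where "R1 = Q * (?G * mat_adjoint Q)"
  have N1: "N1 \<in> carrier_mat r r" and R1: "R1 \<in> carrier_mat r r"
    by (auto intro!: carrier_matI simp: N1_def R1_def P_def Q_def d)
  have N1G1: "N1 = G1"
  proof -
    have "GG \<in> carrier_mat (r + (n - r)) (r + (n - r))" by (intro carrier_matI) (simp_all add: d)
    from fst_split_block[OF this] show ?thesis
      by (simp add: G1_def V_def[symmetric] N1_def P_def GG_def mat_adjoint_mult mat_assoc d)
  qed
  have R1D: "R1 = Sig * (Delta * Sig)"
    by (simp add: R1_def Q_def Delta_def GG_def mat_adjoint_mult adjSig mat_assoc d)
  have dPQ: "dim_row P = n" "dim_col P = r" "dim_row Q = r" "dim_col Q = n"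
    "dim_row N1 = r" "dim_col N1 = r" "dim_row R1 = r" "dim_col R1 = r"
    using P Q N1 R1 by auto
  \<comment> \<open>Both Gram matrices meet in the middle of this product, at inner dimension
    \<open>r\<close>. Rank \<open>r\<close> of the whole therefore makes \<open>N1 * R1\<close>
    nonsingular, hence each factor.\<close>
  have "mink_adj A * A * mink_adj A = (?G * mat_adjoint Q) * (N1 * R1) * (mat_adjoint P * ?G)"
    by (simp add: APQ mink_adj_def N1_def R1_def mat_adjoint_mult mat_assoc dPQ)
  hence "r \<le> crank ((?G * mat_adjoint Q) * (N1 * R1) * (mat_adjoint P * ?G))"
    using rank_cond rankA by simp
  hence "det (N1 * R1) \<noteq> 0"
    by (rule det_nonzero_of_crank_ge[of _ n r _ _ n, rotated 3]) (auto intro!: carrier_matI simp: dPQ)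
  hence det: "det N1 \<noteq> 0" "det R1 \<noteq> 0" using det_mult[OF N1 R1] by auto
  obtain N where N: "N \<in> carrier_mat r r" "N1 * N = 1\<^sub>m r" using inverse_of_det_nonzero[OF N1 det(1)] by metis
  obtain R where R: "R \<in> carrier_mat r r" "R1 * R = 1\<^sub>m r" using inverse_of_det_nonzero[OF R1 det(2)] by metis
  have dNR: "dim_row N = r" "dim_col N = r" "dim_row R = r" "dim_col R = r" using N R by auto
  define Mi where "Mi = G1 * Sig * Delta"
  have dG1: "dim_row G1 = r" "dim_col G1 = r" using N1G1 dPQ by auto
  have Mi: "Mi \<in> carrier_mat r r" by (rule carrier_matI) (simp_all add: Mi_def d dG1)
  \<comment> \<open>By \<open>N1G1\<close> and \<open>R1D\<close>, the product
    \<open>Mi * Sig\<close> equals \<open>N1 * R1\<close>, so the inverse of \<open>Mi\<close> can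
    be read off from \<open>R\<close> and \<open>N\<close>.\<close>
  have "Mi * (Sig * (R * N)) = N1 * ((R1 * R) * N)"
    by (simp add: Mi_def N1G1 R1D mat_assoc d dG1 dNR)
  also have "\<dots> = 1\<^sub>m r" using N R by (simp add: mat_assoc dNR)
  finally have MiM: "Mi * (Sig * (R * N)) = 1\<^sub>m r" .
  have SRN: "Sig * (R * N) \<in> carrier_mat r r" by (rule carrier_matI) (simp_all add: d dNR)
  have MSRN: "M = Sig * (R * N)"
    unfolding M_def Mi_def[symmetric] by (rule inv_mat_eqI[OF Mi SRN MiM])
  have M: "M \<in> carrier_mat r r" using SRN by (simp add: MSRN)
  have MMi: "M * Mi = 1\<^sub>m r"
    using mat_mult_left_right_inverse[OF Mi SRN MiM] by (simp add: MSRN)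
  have dM: "dim_row M = r" "dim_col M = r" using M by auto

  have Am: "mink_inv A = ?G * (U * (mat_adjoint W * (M * (mat_adjoint V * (?Uh * ?G)))))"
  proof -
    have "mink_inv A = ?G * (mat_adjoint Q * (R * (N * (mat_adjoint P * ?G))))"
      unfolding APQ
      by (rule mink_inv_full_rank_factorization[OF P Q N(1) R(1)]) (use N R in \<open>simp_all add: N1_def R1_def\<close>)
    also have "\<dots> = ?G * (U * (mat_adjoint W * (M * (mat_adjoint V * (?Uh * ?G)))))"
      by (simp add: MSRN P_def Q_def mat_adjoint_mult adjSig mat_assoc d dNR)
    finally show ?thesis .
  qed
  have L_iff: "?L \<longleftrightarrow> (\<exists>b c. b \<in> carrier_mat r n \<and> c \<in> carrier_mat n r \<and>
    B = P * b \<and> C = c * Q \<and> mink_inv A = c * b)"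
  proof -
    \<comment> \<open>The one-sided inverses of \<open>P\<close> and \<open>Q\<close> come from
      unitarity of \<open>U\<close>, from \<open>V\<close> and the adjoint of \<open>W\<close>
      having orthonormal columns, and from \<open>Si\<close>.\<close>
    define Pl where "Pl = mat_adjoint V * ?Uh"
    define Qr where "Qr = U * (mat_adjoint W * Si)"
    have 1: "Pl \<in> carrier_mat r n" "Qr \<in> carrier_mat n r"
      by (auto intro!: carrier_matI simp: Pl_def Qr_def d)
    have 2: "Pl * P = 1\<^sub>m r" "Q * Qr = 1\<^sub>m r"
      by (simp_all add: Pl_def Qr_def P_def Q_def mat_assoc d UU' VV WW' SigSi)
    have 3: "mink_inv A \<in> carrier_mat n n" by (rule carrier_matI) (simp_all add: Am d)
    show ?thesis
      using rank_equation_iff[OF P Q 1 2 _ B_dim C_dim 3] rankA APQ by simp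
  qed

  have T_fac: "four_block_mat (J1 * Sig * K) (J1 * Sig * L) (J3 * Sig * K) (J3 * Sig * L) = vcat J1 J3 * S"
    if "J1 \<in> carrier_mat r r" "J3 \<in> carrier_mat (n - r) r" for J1 J3
  proof -
    have dJ: "dim_row J1 = r" "dim_col J1 = r" "dim_row J3 = n - r" "dim_col J3 = r" using that by auto
    show ?thesis unfolding S_def
      by (subst vcat_mult_hcat[of _ r r _ "n - r" _ r _ "n - r"])
        (auto intro!: carrier_matI simp: d dJ mat_assoc)
  qed
  have WM: "vcat (mat_adjoint K * M) (mat_adjoint L * M) = mat_adjoint W * M"
    unfolding W_def
    by (subst mat_adjoint_hcat, simp add: d, subst vcat_mult[of _ r r _ "n - r" _ r])
      (auto intro!: carrier_matI simp: d dM)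
  define Sr where "Sr = mat_adjoint W * Si"
  have Sr: "Sr \<in> carrier_mat n r" by (rule carrier_matI) (simp_all add: Sr_def d)
  have SSr: "S * Sr = 1\<^sub>m r" by (simp add: SW Sr_def mat_assoc d WW' SigSi)
  \<comment> \<open>Multiplying by the adjoint of \<open>V\<close> on the right appends
    \<open>n - r\<close> zero columns; these become the equation \<open>J * B2 = 0\<close>.\<close>
  have WMV: "mat_adjoint W * (M * mat_adjoint V) = hcat (mat_adjoint W * M) (0\<^sub>m n (n - r))"
  proof -
    have "mat_adjoint W * M \<in> carrier_mat n r" by (rule carrier_matI) (simp_all add: d dM)
    hence "(mat_adjoint W * M) * mat_adjoint V = hcat (mat_adjoint W * M) (0\<^sub>m n (n - r))"
      unfolding adjV by (subst mult_hcat[of _ n r _ r _ "n - r"]) (auto simp: mat_assoc d dM)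
    thus ?thesis by (simp add: mat_assoc d dM)
  qed
  note R_unfold = Let_def W_def[symmetric] S_def[symmetric] GG_def[symmetric] G1_def[symmetric]
    Delta_def[symmetric] M_def[symmetric] WM
  show ?thesis unfolding L_iff
  proof
    assume "\<exists>b c. b \<in> carrier_mat r n \<and> c \<in> carrier_mat n r \<and>
      B = P * b \<and> C = c * Q \<and> mink_inv A = c * b"
    then obtain b c where b: "b \<in> carrier_mat r n" and c: "c \<in> carrier_mat n r"
      and Bb: "B = P * b" and Cc: "C = c * Q" and cb: "mink_inv A = c * b" by blast
    have dbc: "dim_row b = r" "dim_col b = n" "dim_row c = n" "dim_col c = r" using b c by auto
    \<comment> \<open>\<open>J\<close> and \<open>\<beta>\<close> solve \<open>c = G U J\<close> and
      \<open>b = \<beta> U^* G\<close>, because \<open>G\<close> is its own inverse and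
      \<open>U\<close> is unitary.\<close>
    define J where "J = ?Uh * (?G * c)"
    define \<beta> where "\<beta> = b * (?G * U)"
    have J: "J \<in> carrier_mat n r" and \<beta>: "\<beta> \<in> carrier_mat r n"
      by (auto intro!: carrier_matI simp: J_def \<beta>_def d dbc)
    obtain J1 J3 where J13: "J1 \<in> carrier_mat r r" "J3 \<in> carrier_mat (n - r) r" "J = vcat J1 J3"
      using obtain_vcat[of J r "n - r" r] J by auto
    obtain B1 B2 where B12: "B1 \<in> carrier_mat r r" "B2 \<in> carrier_mat r (n - r)" "\<beta> = hcat B1 B2"
      using obtain_hcat[of \<beta> r r "n - r"] \<beta> by auto
    \<comment> \<open>In these coordinates the condition \<open>mink_inv A = c * b\<close> loses the
      outer factors \<open>G\<close> and \<open>U\<close> and splits by column blocks.\<close>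
    have "J * \<beta> = ?Uh * (?G * (mink_inv A * (?G * U)))"
      by (simp add: J_def \<beta>_def cb mat_assoc d dbc)
    also have "\<dots> = mat_adjoint W * (M * mat_adjoint V)"
      by (simp add: Am mat_assoc d dM UU UU')
    finally have "hcat (J * B1) (J * B2) = hcat (mat_adjoint W * M) (0\<^sub>m n (n - r))"
      unfolding WMV B12(3) by (simp add: mult_hcat[OF J B12(1,2)])
    hence JB: "J * B1 = mat_adjoint W * M" "J * B2 = 0\<^sub>m n (n - r)"
      by (rule hcat_inj[of _ n r _ "n - r", rotated 4];
        use J B12 in \<open>auto intro!: carrier_matI simp: d dM\<close>)+
    note fe = factor_equation_imp[OF J S Sr W M Mi B12(1) SSr WW MMi JB(1)]
    have dJB: "dim_row J = n" "dim_col J = r" "dim_row B1 = r" "dim_col B1 = r" "dim_row B2 = r"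
      "dim_col B2 = n - r" "dim_row Mi = r" "dim_col Mi = r" "dim_row S = r" "dim_col S = n"
      "dim_row Sr = n" "dim_col Sr = r"
      using J B12 Mi S Sr by auto
    \<comment> \<open>The left inverse of \<open>J\<close> from \<open>fe(1)\<close> turns
      \<open>J * B2 = 0\<close> into \<open>B2 = 0\<close>.\<close>
    have B20: "B2 = 0\<^sub>m r (n - r)"
      using mat_mult_cancel[OF fe(1), of B2] JB(2) by (simp add: mat_assoc dJB d)
    \<comment> \<open>The inner inverse supplied by \<open>fe(3)\<close>. With it, the choice of
      zero for both \<open>Y1\<close> and \<open>Y2\<close> reproduces the given \<open>B1\<close>
      and \<open>B2\<close>.\<close>
    define T1 where "T1 = Sr * (B1 * (Mi * W))"
    have T1: "T1 \<in> carrier_mat n n" by (rule carrier_matI) (simp_all add: T1_def dJB d)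
    have dT1: "dim_row T1 = n" "dim_col T1 = n" using T1 by auto
    have z: "(1\<^sub>m n - T1 * (J * S)) * 0\<^sub>m n k = 0\<^sub>m n k" for k
      by (simp add: dT1 dJB)
    have B1_eq: "S * (T1 * (mat_adjoint W * M) + (1\<^sub>m n - T1 * (J * S)) * 0\<^sub>m n r) = B1"
    proof -
      have "T1 * (mat_adjoint W * M) \<in> carrier_mat n r" by (rule carrier_matI) (simp_all add: dT1 dM)
      thus ?thesis using fe(4)[folded T1_def] by (simp add: z)
    qed
    have B2_eq: "S * ((1\<^sub>m n - T1 * (J * S)) * 0\<^sub>m n (n - r)) = B2"
      by (simp add: z B20 dJB)
    have "B = U * (V * \<beta>) * ?Uh * ?G"
      by (simp add: Bb \<beta>_def P_def mat_assoc d dbc UU' mat_mult_cancel[OF UU(1)])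
    hence B_eq: "B = U * four_block_mat B1 B2 (0\<^sub>m (n - r) r) (0\<^sub>m (n - r) (n - r)) * ?Uh * ?G"
      by (simp only: block_VX[OF B12(1,2)] B12(3))
    have C_eq: "C = ?G * U * (J * S) * ?Uh"
      by (simp add: Cc J_def SW Q_def mat_assoc d dbc UU')
    show ?R
      unfolding R_unfold
      by (rule exI[of _ J1], rule exI[of _ J3], rule exI[of _ "0\<^sub>m n r"], rule exI[of _ "0\<^sub>m n (n - r)"],
          rule exI[of _ T1], unfold T_fac[OF J13(1,2)] J13(3)[symmetric] B1_eq B2_eq)
        (intro conjI J13 T1 fe(2) B_eq C_eq zero_carrier_mat fe(3)[folded T1_def])
  next
    assume ?R
    then obtain J1 J3 Y1 Y2 T1 where J1: "J1 \<in> carrier_mat r r" and J3: "J3 \<in> carrier_mat (n - r) r"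
      and Y1: "Y1 \<in> carrier_mat n r" and Y2: "Y2 \<in> carrier_mat n (n - r)"
      and raw: "let T = four_block_mat (J1 * Sig * K) (J1 * Sig * L) (J3 * Sig * K) (J3 * Sig * L)
            in mat_kernel (mat_adjoint T) \<subseteq> mat_kernel W \<and>
               T1 \<in> carrier_mat n n \<and> T * T1 * T = T \<and>
               (let B1 = S * (T1 * (mat_adjoint W * M) + (1\<^sub>m n - T1 * T) * Y1);
                    B2 = S * ((1\<^sub>m n - T1 * T) * Y2)
                in B = U * four_block_mat B1 B2 (0\<^sub>m (n - r) r) (0\<^sub>m (n - r) (n - r)) * ?Uh * ?G \<and>
                   C = ?G * U * T * ?Uh)"
      unfolding R_unfold by blast
    define J where "J = vcat J1 J3"
    define B1 where "B1 = S * (T1 * (mat_adjoint W * M) + (1\<^sub>m n - T1 * (J * S)) * Y1)"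
    define B2 where "B2 = S * ((1\<^sub>m n - T1 * (J * S)) * Y2)"
    have J: "J \<in> carrier_mat n r" using vcat_carrier[OF J1 J3] by (simp add: J_def)
    from raw have ker: "mat_kernel (mat_adjoint (J * S)) \<subseteq> mat_kernel W"
      and T1: "T1 \<in> carrier_mat n n" and inner: "J * S * T1 * (J * S) = J * S"
      and Braw: "B = U * four_block_mat B1 B2 (0\<^sub>m (n - r) r) (0\<^sub>m (n - r) (n - r)) * ?Uh * ?G"
      and Craw: "C = ?G * U * (J * S) * ?Uh"
      unfolding T_fac[OF J1 J3] J_def[symmetric] Let_def B1_def B2_def by blast+
    \<comment> \<open>These facts give \<open>J * B1 = mat_adjoint W * M\<close> and
      \<open>B2 = 0\<close> for every admissible choice of \<open>T1\<close>, \<open>Y1\<close> and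
      \<open>Y2\<close>.\<close>
    note fe = factor_equation_of_param[OF J S Sr W M Y1 Y2 T1 SSr WW ker inner, folded B1_def B2_def]
    have dJ: "dim_row J = n" "dim_col J = r" "dim_row T1 = n" "dim_col T1 = n" "dim_row S = r" "dim_col S = n"
      "dim_col Y1 = r" "dim_col Y2 = n - r" "dim_row Y1 = n" "dim_row Y2 = n"
      using J T1 S Y1 Y2 by auto
    have B1: "B1 \<in> carrier_mat r r" by (rule carrier_matI) (simp_all add: B1_def dJ)
    have B2: "B2 \<in> carrier_mat r (n - r)" by (simp add: fe(2))
    define \<beta> where "\<beta> = hcat B1 B2"
    have \<beta>: "\<beta> \<in> carrier_mat r n" using hcat_carrier[OF B1 B2] by (simp add: \<beta>_def)
    have d\<beta>: "dim_row \<beta> = r" "dim_col \<beta> = n" using \<beta> by auto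
    have "J * \<beta> = hcat (J * B1) (J * B2)" unfolding \<beta>_def by (rule mult_hcat[OF J B1 B2])
    also have "\<dots> = mat_adjoint W * (M * mat_adjoint V)"
      by (simp add: WMV fe dJ)
    finally have J\<beta>: "J * \<beta> = mat_adjoint W * (M * mat_adjoint V)" .
    have J\<beta>': "J * (\<beta> * X) = mat_adjoint W * (M * (mat_adjoint V * X))" if "dim_row X = n" for X
      using mat_mult_cancel[OF J\<beta>, of X] that by (simp add: mat_assoc d d\<beta> dJ dM)
    \<comment> \<open>The substitution of the forward direction in reverse;
      \<open>J * \<beta>\<close> is exactly the core of the closed form \<open>Am\<close>.\<close>
    let ?b = "\<beta> * (?Uh * ?G)" and ?c = "?G * (U * J)"
    have "B = P * ?b"
      unfolding Braw block_VX[OF B1 B2] \<beta>_def[symmetric] by (simp add: P_def mat_assoc d d\<beta>)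
    moreover have "C = ?c * Q"
      unfolding Craw by (simp add: Q_def SW mat_assoc d dJ)
    moreover have "mink_inv A = ?c * ?b"
      unfolding Am by (simp add: mat_assoc d dJ d\<beta> J\<beta>')
    moreover have "?b \<in> carrier_mat r n" "?c \<in> carrier_mat n r"
      by (auto intro!: carrier_matI simp: d dJ d\<beta>)
    ultimately show "\<exists>b c. b \<in> carrier_mat r n \<and> c \<in> carrier_mat n r \<and>
      B = P * b \<and> C = c * Q \<and> mink_inv A = c * b" by blast
  qed
qed

end
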